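(* Let $\alpha\in\mathbb{H}$. (1) One has \[m_{\mathbb{H}}(x-\alpha)=\begin{cases}\tfrac14|\alpha|^2 & \text{if } |\alpha|\le 1,\\ \tfrac14|\alpha|^{-2}+\log|\alpha| & \text{if } |\alpha|>1.\end{cases}\] (2) If $\alpha\neq 0$ and $\phi=\arccos(\operatorname{Re}\alpha/|\alpha|)$, then \[m_{\mathbb{H}}(x^2-2\operatorname{Re}\alpha\cdot x+|\alpha|^2)=\begin{cases}\tfrac12|\alpha|^2\cos 2\phi & \text{if } |\alpha|\le 1,\\ \tfrac12|\alpha|^{-2}\cos 2\phi+2\log|\alpha| & \text{if } |\alpha|>1.\end{cases}\] (3) Let $P\in\mathbb{R}[x]$ be a nonzero real polynomial with factorization over $\mathbb{R}$ \[P(x)=c\prod_h (x-\alpha_h)^{n_h}\prod_\ell (x^2-2\operatorname{Re}\beta_\ell\cdot x+|\beta_\ell|^2)^{m_\ell},\] with $c\in\mathbb{R}\setminus\{0\}$, $\alpha_h\in\mathbb{R}$, $\beta_\ell\in\mathbb{C}\setminus\mathbb{R}$, $n_h,m_\ell\in\mathbb{N}$. Then \[m_{\mathbb{H}}(P)=\log|c|+\sum_h n_h\, m_{\mathbb{H}}(x-\alpha_h)+\sum_\ell m_\ell\, m_{\mathbb{H}}(x^2-2\operatorname{Re}\beta_\ell\cdot x+|\beta_\ell|^2).\]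
   Context: $\mathbb{H}$ denotes the real quaternions with basis $1,i,j,k$ ($i^2=j^2=k^2=-1$, $ij=k=-ji$, etc.); for $q=x_0+x_1i+x_2j+x_3k$, $\operatorname{Re}q=x_0$, $\operatorname{Im}q=x_1i+x_2j+x_3k$, $|q|^2=x_0^2+x_1^2+x_2^2+x_3^2$. Let $\mathbb{T}^n(\mathbb{H})=\{(x_1,\dots,x_n)\in\mathbb{H}^n: |x_1|=\dots=|x_n|=1\}$ (a product of copies of the unit 3-sphere $S^3\subset\mathbb{H}\cong\mathbb{R}^4$), with probability Haar measure $\mu$ (the product of the normalized surface measures on $S^3$). For a function $P:\mathbb{H}^n\to\mathbb{H}$ given by a (possibly non-commutative) polynomial expression with quaternion coefficients, the quaternionic Mahler measure is $m_{\mathbb{H}}(P)=\int_{\mathbb{T}^n(\mathbb{H})}\log|P(x_1,\dots,x_n)|\,d\mu$. Real polynomials are evaluated at quaternion arguments in the obvious way. *)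

theory Defs
  imports "HOL-Analysis.Analysis" "HOL-Computational_Algebra.Polynomial"
begin

text \<open>Real quaternions x0 + x1 i + x2 j + x3 k, represented as 4-tuples of reals.
  The product type carries the Euclidean norm sqrt(x0^2+x1^2+x2^2+x3^2),
  componentwise addition/subtraction, and Lebesgue measure on R^4.\<close>

type_synonym quat = "real \<times> real \<times> real \<times> real"

definition qmul :: "quat \<Rightarrow> quat \<Rightarrow> quat" where
  "qmul p q = (case p of (a0, a1, a2, a3) \<Rightarrow> case q of (b0, b1, b2, b3) \<Rightarrow>
     (a0*b0 - a1*b1 - a2*b2 - a3*b3,
      a0*b1 + a1*b0 + a2*b3 - a3*b2,
      a0*b2 - a1*b3 + a2*b0 + a3*b1,
      a0*b3 + a1*b2 - a2*b1 + a3*b0))"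

definition qone :: quat where "qone = (1, 0, 0, 0)"

definition qof_real :: "real \<Rightarrow> quat" where "qof_real r = (r, 0, 0, 0)"

definition qre :: "quat \<Rightarrow> real" where "qre q = fst q"

fun qpow :: "quat \<Rightarrow> nat \<Rightarrow> quat" where
  "qpow x 0 = qone"
| "qpow x (Suc n) = qmul x (qpow x n)"

definition qpoly :: "real poly \<Rightarrow> quat \<Rightarrow> quat" where
  "qpoly P x = (\<Sum>k\<le>degree P. coeff P k *\<^sub>R qpow x k)"

text \<open>Normalized surface (Haar probability) measure on the unit sphere S^3 of H = R^4:
  the push-forward of the uniform probability measure on the unit ball under radial
  projection x \<mapsto> x/|x| (the cone-measure description of normalized surface measure).\<close>
definition sphere3 :: "quat measure" where
  "sphere3 = distr (uniform_measure lborel (ball 0 1)) borel sgn"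

definition mH :: "(quat \<Rightarrow> quat) \<Rightarrow> real" where
  "mH P = (\<integral>x. ln (norm (P x)) \<partial>sphere3)"

end

theory Submission
  imports Defs "HOL-Probability.Probability_Measure"
begin

text \<open>On the sphere, the slice map sends x = x0 + v to the point x0 + i |v| of the unit circle, and
  real polynomials satisfy |P(x)| = |P(slice x)|. All integrals in the theorem (the first one after
  rotating alpha to the nonnegative real axis) thereby reduce to
  ln |slice x - a| + ln |slice x - cnj a| for complex a. For |a| < 1 this equals
  the sum over n of -2 Re(a^n) Re((slice x)^n) / n. Under the pushforward of the
  surface measure by the angle, (2/pi) sin^2 on [0, pi], only the moment n = 2 contributes.
  The case |a| = 1 is the limit of r a for r -> 1 (Fatou for integrability, then dominated
  convergence), and |a| > 1 follows by inversion in the circle.\<close>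

subsection \<open>Rotation invariance of Lebesgue measure\<close>

text \<open>The second moment is singled out because
  \<open>(2/pi) sin^2 t = (1 - cos 2t) / pi\<close> is orthogonal on [0, pi] to every
  \<open>cos (n t)\<close> except those with n = 0 and n = 2, and the logarithmic series has no
  constant term. The coefficient \<open>- Re (a^2)\<close> meets the moment \<open>- 1/2\<close>,
  whence \<open>Re (a^2) / 2\<close>; a real root counts as half of a conjugate pair, whence the 1/4
  in the linear case. For nonreal alpha the distance |x - alpha| is not a function of
  \<open>slice x\<close>, hence the rotation. \<open>sphere3\<close> is defined by radial projection
  from the ball, so its invariance has to be inherited from Lebesgue measure on R^4. The angular
  density is found through the cotangent s of the angle: writing x0 = s |v| separates the integral
  over the ball into a factor in s and a factor in v. For |a| = 1 the geometric majorant of the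
  series is lost and the logarithms are unbounded below, so integrability itself becomes a claim to
  prove.\<close>

lemma emeasure_lborel_unit_ball_neq_0: "emeasure lborel (ball (0::'a::euclidean_space) 1) \<noteq> 0"
  using emeasure_ball[of 1 "0::'a"] unit_ball_vol_pos[of "real DIM('a)"]
  by (simp del: unit_ball_vol_pos)

text \<open>Uniqueness of Haar measure: Fubini gives \<open>M(A) * lborel(B) = lborel(A) * M(B)\<close>, used for the unit ball B.\<close>

lemma translation_invariant_eq_lborel:
  fixes M :: "'a::euclidean_space measure"
  assumes sets[measurable_cong]: "sets M = sets borel"
    and inv: "\<And>c. distr M borel ((+) c) = M"
    and ball: "\<And>r. emeasure M (ball 0 r) = emeasure lborel (ball (0::'a) r)"
  shows "M = lborel"
proof -
  let ?B = "ball (0::'a) 1"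
  have [measurable]: "?B \<in> sets borel" by simp
  have "sigma_finite_measure M"
  proof
    have "\<Union> (range (\<lambda>n. ball (0::'a) (real n))) = UNIV"
      using reals_Archimedean2 by auto
    then show "\<exists>A. countable A \<and> A \<subseteq> sets M \<and> \<Union> A = space M \<and> (\<forall>a\<in>A. emeasure M a \<noteq> \<infinity>)"
      using sets_eq_imp_space_eq[OF sets]
      by (intro exI[of _ "range (\<lambda>n. ball (0::'a) (real n))"])
        (auto simp: sets ball less_imp_neq[OF emeasure_lborel_ball_finite, simplified])
  qed
  then interpret M: sigma_finite_measure M .
  interpret P: pair_sigma_finite M lborel ..
  show ?thesis
  proof (rule measure_eqI)
    fix A assume "A \<in> sets M"
    then have A[measurable]: "A \<in> sets borel" by (simp add: sets)
    have "emeasure M A * emeasure lborel ?B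
        = (\<integral>\<^sup>+x. \<integral>\<^sup>+y. indicator A x * indicator ?B y \<partial>lborel \<partial>M)"
      by (subst nn_integral_cmult, measurable) (auto simp: nn_integral_multc sets)
    \<comment> \<open>Shifting \<open>y\<close> by \<open>x\<close> uses the invariance of Lebesgue
      measure. After the exchange, shifting \<open>x\<close> by \<open>- y\<close> uses that of
      \<open>M\<close> and leaves \<open>A\<close> evaluated at \<open>x - y\<close>, whose integral
      over \<open>y\<close> no longer depends on \<open>x\<close>.\<close>
    also have "\<dots> = (\<integral>\<^sup>+x. \<integral>\<^sup>+y. indicator A x * indicator ?B (x + y) \<partial>lborel \<partial>M)"
    proof (rule nn_integral_cong)
      fix x
      have "(\<integral>\<^sup>+y. indicator A x * indicator ?B y \<partial>lborel)
          = (\<integral>\<^sup>+y. indicator A x * indicator ?B y \<partial>distr lborel borel ((+) x))"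
        by (simp add: lborel_distr_plus)
      also have "\<dots> = (\<integral>\<^sup>+y. indicator A x * indicator ?B (x + y) \<partial>lborel)"
        by (subst nn_integral_distr) auto
      finally show "(\<integral>\<^sup>+y. indicator A x * indicator ?B y \<partial>lborel)
          = (\<integral>\<^sup>+y. indicator A x * indicator ?B (x + y) \<partial>lborel)" .
    qed
    also have "\<dots> = (\<integral>\<^sup>+y. \<integral>\<^sup>+x. indicator A x * indicator ?B (x + y) \<partial>M \<partial>lborel)"
      by (intro P.Fubini'[symmetric]) measurable
    also have "\<dots> = (\<integral>\<^sup>+y. \<integral>\<^sup>+x. indicator A (x - y) * indicator ?B x \<partial>M \<partial>lborel)"
    proof (rule nn_integral_cong)
      fix y
      have "(\<integral>\<^sup>+x. indicator A x * indicator ?B (x + y) \<partial>M)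
          = (\<integral>\<^sup>+x. indicator A x * indicator ?B (x + y) \<partial>distr M borel ((+) (- y)))"
        by (simp add: inv)
      also have "\<dots> = (\<integral>\<^sup>+x. indicator A (x - y) * indicator ?B x \<partial>M)"
        by (subst nn_integral_distr) auto
      finally show "(\<integral>\<^sup>+x. indicator A x * indicator ?B (x + y) \<partial>M)
          = (\<integral>\<^sup>+x. indicator A (x - y) * indicator ?B x \<partial>M)" .
    qed
    also have "\<dots> = (\<integral>\<^sup>+x. \<integral>\<^sup>+y. indicator A (x - y) * indicator ?B x \<partial>lborel \<partial>M)"
      by (intro P.Fubini') measurable
    also have "\<dots> = (\<integral>\<^sup>+x. emeasure lborel A * indicator ?B x \<partial>M)"
    proof (rule nn_integral_cong)
      fix x
      have "emeasure lborel A = (\<integral>\<^sup>+y. indicator A y \<partial>(lborel :: 'a measure))" by simp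
      also have "\<dots> = (\<integral>\<^sup>+y. indicator A (x - y) \<partial>lborel)"
        by (subst lborel_affine[of "-1" x])
           (simp_all add: nn_integral_density nn_integral_distr)
      finally show "(\<integral>\<^sup>+y. indicator A (x - y) * indicator ?B x \<partial>lborel)
          = emeasure lborel A * indicator ?B x"
        by (simp add: nn_integral_multc)
    qed
    also have "\<dots> = emeasure lborel A * emeasure lborel ?B"
      by (simp add: nn_integral_cmult ball sets)
    finally show "emeasure M A = emeasure lborel A"
      using emeasure_lborel_ball_finite[of "0::'a" 1] emeasure_lborel_unit_ball_neq_0[where 'a='a]
      by (simp add: mult.commute[of _ "emeasure lborel ?B"] ennreal_mult_cancel_left less_imp_neq)
  qed (simp add: sets)
qed

lemma borel_measurable_orthogonal_transformation:
  fixes f :: "'a::euclidean_space \<Rightarrow> 'a"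
  shows "orthogonal_transformation f \<Longrightarrow> f \<in> borel_measurable borel"
  by (intro borel_measurable_continuous_onI linear_continuous_on linear_conv_bounded_linear[THEN iffD1]
      orthogonal_transformation_linear)

text \<open>By linearity and surjectivity, a translation after \<open>f\<close> is \<open>f\<close>
  after another translation, so the image measure is again translation invariant. Balls around 0 are
  their own preimages, which fixes the normalization.\<close>

lemma lborel_distr_orthogonal_transformation:
  fixes f :: "'a::euclidean_space \<Rightarrow> 'a"
  assumes f: "orthogonal_transformation f"
  shows "distr lborel borel f = lborel"
proof (rule translation_invariant_eq_lborel)
  have [measurable]: "f \<in> borel_measurable borel"
    using f by (rule borel_measurable_orthogonal_transformation)
  show "distr (distr lborel borel f) borel ((+) c) = distr lborel borel f" for c
  proof -
    obtain d where d: "f d = c"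
      using orthogonal_transformation_surj[OF f] by (metis surjD)
    have "(+) c \<circ> f = f \<circ> (+) d"
      using d orthogonal_transformation_linear[OF f] by (auto simp: linear_add)
    then have "distr (distr lborel borel f) borel ((+) c) = distr (distr lborel borel ((+) d)) borel f"
      by (simp add: distr_distr)
    then show ?thesis by (simp add: lborel_distr_plus)
  qed
  show "emeasure (distr lborel borel f) (ball 0 r) = emeasure lborel (ball (0::'a) r)" for r
  proof -
    have "f -` ball 0 r = ball 0 r"
      using orthogonal_transformation_norm[OF f] by auto
    then show ?thesis by (subst emeasure_distr) auto
  qed
qed simp

lemma orthogonal_transformation_exists_norm:
  fixes a b :: "'a::euclidean_space"
  assumes "norm a = norm b"
  obtains f where "orthogonal_transformation f" "f a = b"
proof
  \<comment> \<open>the reflection along \<open>a - b\<close>\<close>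
  define w where "w = a - b"
  define f where "f x = x - (2 * (x \<bullet> w) / (w \<bullet> w)) *\<^sub>R w" for x
  have lin: "linear f"
    by (rule linearI) (auto simp: f_def algebra_simps add_divide_distrib inner_add_left)
  show "orthogonal_transformation f"
    unfolding orthogonal_transformation_def
    using lin
    by (cases "w = 0") (auto simp: f_def inner_diff inner_commute field_simps power2_eq_square)
  have "a \<bullet> a = b \<bullet> b" using assms by (simp add: norm_eq_sqrt_inner)
  \<comment> \<open>Equality of the norms enters here: it makes the coefficient of \<open>w\<close>
    in \<open>f a\<close> equal to 1, so that \<open>f a = a - w\<close>.\<close>
  then have ww: "w \<bullet> w = 2 * (a \<bullet> w)"
    by (simp add: w_def inner_diff inner_commute)
  show "f a = b"
  proof (cases "w = 0")
    case False
    then have "w \<bullet> w \<noteq> 0" by simp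
    then have "2 * (a \<bullet> w) / (w \<bullet> w) = 1" using ww by (metis divide_self)
    then have "f a = a - w" unfolding f_def by (simp only: scaleR_one)
    then show ?thesis by (simp add: w_def)
  qed (simp add: f_def w_def)
qed

subsection \<open>The surface measure on the 3-sphere\<close>

lemma sets_sphere3[measurable_cong, simp]: "sets sphere3 = sets borel"
  by (simp add: sphere3_def)

lemma space_sphere3[simp]: "space sphere3 = UNIV"
  by (simp add: sphere3_def)

lemma prob_space_sphere3: "prob_space sphere3"
  unfolding sphere3_def
  by (intro prob_space.prob_space_distr prob_space_uniform_measure)
    (auto simp: emeasure_lborel_unit_ball_neq_0 less_imp_neq[OF emeasure_lborel_ball_finite, simplified])

interpretation sphere3: prob_space sphere3
  by (rule prob_space_sphere3)

lemma measure_sphere3_UNIV[simp]: "measure sphere3 UNIV = 1"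
  using sphere3.prob_space by simp

text \<open>An orthogonal map commutes with \<open>sgn\<close> and preserves the unit ball, so the
  invariance of Lebesgue measure passes through the radial projection.\<close>

lemma sphere3_distr_orthogonal_transformation:
  assumes f: "orthogonal_transformation f"
  shows "distr sphere3 borel f = sphere3"
proof (rule measure_eqI)
  have [measurable]: "f \<in> borel_measurable borel"
    using f by (rule borel_measurable_orthogonal_transformation)
  have [measurable]: "sgn -` A \<in> sets borel" if "A \<in> sets borel" for A :: "quat set"
    using measurable_sets_borel[OF borel_measurable_sgn that] by simp
  have sgn: "f (sgn x) = sgn (f x)" for x
    using orthogonal_transformation_linear[OF f] orthogonal_transformation_norm[OF f, of x]
    by (simp add: sgn_div_norm linear_scale)
  fix A assume "A \<in> sets (distr sphere3 borel f)"
  then have [measurable]: "A \<in> sets borel" by simp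
  have "emeasure (distr sphere3 borel f) A
     = emeasure lborel (ball 0 1 \<inter> sgn -` f -` A) / emeasure lborel (ball (0::quat) 1)"
    unfolding sphere3_def by (simp add: emeasure_distr vimage_def)
  also have "ball 0 1 \<inter> sgn -` f -` A = f -` (ball 0 1 \<inter> sgn -` A)"
    by (intro set_eqI) (simp add: sgn orthogonal_transformation_norm[OF f])
  also have "emeasure lborel \<dots> = emeasure (distr lborel borel f) (ball 0 1 \<inter> sgn -` A)"
    by (subst emeasure_distr) auto
  also have "\<dots> = emeasure lborel (ball 0 1 \<inter> sgn -` A)"
    by (simp add: lborel_distr_orthogonal_transformation[OF f])
  also have "\<dots> / emeasure lborel (ball (0::quat) 1) = emeasure sphere3 A"
    unfolding sphere3_def by (simp add: emeasure_distr)
  finally show "emeasure (distr sphere3 borel f) A = emeasure sphere3 A" .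
qed (simp add: sphere3_def)

section \<open>The law of the real part on the sphere\<close>

lemma borel_measurable_fst_borel[measurable]:
  "fst \<in> borel_measurable (borel :: ('a::topological_space \<times> 'b::topological_space) measure)"
  by (intro borel_measurable_continuous_onI continuous_intros)

lemma nn_integral_lborel_scaleR:
  fixes f :: "'a::euclidean_space \<Rightarrow> ennreal"
  assumes [measurable]: "f \<in> borel_measurable borel" and "c > 0"
  shows "(\<integral>\<^sup>+x. f x \<partial>lborel) = ennreal (c ^ DIM('a)) * (\<integral>\<^sup>+x. f (c *\<^sub>R x) \<partial>lborel)"
  using \<open>c > 0\<close>
  by (subst lborel_affine[of c 0])
     (simp_all add: nn_integral_density nn_integral_distr nn_integral_cmult)

text \<open>Substituting \<open>x = norm y * s\<close> and then rescaling \<open>y\<close> separates the variables, so the constant \<open>K\<close> need not be computed.\<close>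

lemma nn_integral_ball_fst_sgn:
  fixes g :: "real \<Rightarrow> ennreal"
  assumes [measurable]: "g \<in> borel_measurable borel"
  defines "K \<equiv> (\<integral>\<^sup>+y. ennreal (norm y) * indicator (ball 0 1) y \<partial>(lborel :: 'b::euclidean_space measure))"
  shows "(\<integral>\<^sup>+x. g (fst (sgn x)) * indicator (ball 0 1) x \<partial>(lborel :: (real \<times> 'b) measure))
    = (\<integral>\<^sup>+s. K * (g (s / sqrt (1 + s\<^sup>2)) * ennreal (1 / sqrt (1 + s\<^sup>2) ^ Suc DIM('b))) \<partial>lborel)"
proof -
  have [measurable]: "(\<lambda>x. fst (sgn x)) \<in> borel_measurable (borel :: (real \<times> 'b) measure)"
    by (rule measurable_compose[OF borel_measurable_sgn]) measurable
  have [measurable]: "ball (0::real \<times> 'b) 1 \<in> sets borel" "ball (0::'b) 1 \<in> sets borel"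
    by simp_all
  define G where "G x = g (fst (sgn x)) * indicator (ball 0 1) x" for x :: "real \<times> 'b"
  have [measurable]: "G \<in> borel_measurable borel"
    unfolding G_def by measurable
  define w :: "real \<Rightarrow> real" where "w s = sqrt (1 + s\<^sup>2)" for s
  have [measurable]: "w \<in> borel_measurable borel" unfolding w_def by measurable
  have w: "w s > 0" for s by (simp add: w_def add_pos_nonneg)
  have norm_pair: "norm (norm y * s, y) = norm y * w s" for s and y :: 'b
  proof -
    have "(norm y * s)\<^sup>2 + (norm y)\<^sup>2 = (norm y)\<^sup>2 * (1 + s\<^sup>2)" by (simp add: algebra_simps)
    then show ?thesis by (simp add: norm_Pair w_def real_sqrt_mult)
  qed
  \<comment> \<open>The substitution \<open>x = norm y * s\<close> degenerates at
    \<open>y = 0\<close>, a null set.\<close>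
  have AE0: "AE y in lborel. y \<noteq> (0::'b)" by (rule AE_lborel_singleton)
  have "(\<integral>\<^sup>+x. G x \<partial>lborel)
      = (\<integral>\<^sup>+y. (\<integral>\<^sup>+x. G (x, y) \<partial>lborel) \<partial>(lborel :: 'b measure))"
    by (rule lborel_pair.nn_integral_snd[unfolded lborel_prod, symmetric]) measurable
  also have "\<dots> = (\<integral>\<^sup>+y. (\<integral>\<^sup>+s. ennreal (norm y) * g (s / w s) * indicator (ball 0 1) (w s *\<^sub>R y) \<partial>lborel)
      \<partial>(lborel :: 'b measure))"
  proof (rule nn_integral_cong_AE, use AE0 in eventually_elim)
    fix y :: 'b assume y: "y \<noteq> 0"
    have "(\<integral>\<^sup>+x. G (x, y) \<partial>lborel)
      = ennreal (norm y) * (\<integral>\<^sup>+s. G (norm y * s, y) \<partial>lborel)"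
      using y by (subst nn_integral_real_affine[of _ "norm y" 0]) simp_all
    also have "\<dots> = (\<integral>\<^sup>+s. ennreal (norm y) * G (norm y * s, y) \<partial>lborel)"
      by (subst nn_integral_cmult) auto
    also have "\<dots> = (\<integral>\<^sup>+s. ennreal (norm y) * g (s / w s) * indicator (ball 0 1) (w s *\<^sub>R y) \<partial>lborel)"
    proof (rule nn_integral_cong)
      fix s
      have "fst (sgn (norm y * s, y)) = s / w s"
        using y w[of s] by (simp add: sgn_div_norm norm_pair) (simp add: field_simps)
      moreover have "norm (norm y * s, y) = norm (w s *\<^sub>R y)"
        using w[of s] by (simp add: norm_pair)
      ultimately show "ennreal (norm y) * G (norm y * s, y)
        = ennreal (norm y) * g (s / w s) * indicator (ball 0 1) (w s *\<^sub>R y)"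
        by (simp add: G_def indicator_def mult.assoc)
    qed
    finally show "(\<integral>\<^sup>+x. G (x, y) \<partial>lborel)
      = (\<integral>\<^sup>+s. ennreal (norm y) * g (s / w s) * indicator (ball 0 1) (w s *\<^sub>R y) \<partial>lborel)" .
  qed
  also have "\<dots> = (\<integral>\<^sup>+s. (\<integral>\<^sup>+y. ennreal (norm y) * g (s / w s) * indicator (ball 0 1) (w s *\<^sub>R y)
      \<partial>(lborel :: 'b measure)) \<partial>lborel)"
    by (rule lborel_pair.Fubini') measurable
  also have "\<dots> = (\<integral>\<^sup>+s. K * (g (s / w s) * ennreal (1 / w s ^ Suc DIM('b))) \<partial>lborel)"
  proof (rule nn_integral_cong)
    fix s
    have "(\<integral>\<^sup>+y. ennreal (norm y) * g (s / w s) * indicator (ball 0 1) (w s *\<^sub>R y) \<partial>(lborel :: 'b measure))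
      = ennreal ((1 / w s) ^ DIM('b)) * (\<integral>\<^sup>+y. ennreal (norm ((1 / w s) *\<^sub>R y)) * g (s / w s)
          * indicator (ball 0 1) (w s *\<^sub>R (1 / w s) *\<^sub>R y) \<partial>(lborel :: 'b measure))"
      using w[of s] by (subst nn_integral_lborel_scaleR[of _ "1 / w s"]) simp_all
    also have "\<dots> = ennreal ((1 / w s) ^ DIM('b)) *
        (\<integral>\<^sup>+y. (ennreal (1 / w s) * g (s / w s)) * (ennreal (norm y) * indicator (ball 0 1) y) \<partial>(lborel :: 'b measure))"
    proof -
      have "ennreal (norm ((1 / w s) *\<^sub>R y)) = ennreal (1 / w s) * ennreal (norm y)"
        and "w s *\<^sub>R (1 / w s) *\<^sub>R y = y" for y :: 'b
        using w[of s] by (simp_all flip: ennreal_mult)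
      then show ?thesis by (simp only: mult_ac)
    qed
    also have "\<dots> = ennreal ((1 / w s) ^ DIM('b)) * ((ennreal (1 / w s) * g (s / w s)) * K)"
      unfolding K_def by (subst nn_integral_cmult) auto
    also have "\<dots> = K * (g (s / w s) * (ennreal ((1 / w s) ^ DIM('b)) * ennreal (1 / w s)))"
      by (simp add: mult_ac)
    \<comment> \<open>Rescaling the volume of \<open>y\<close> contributes \<open>DIM('b)\<close>
      factors \<open>1 / w s\<close>; the Jacobian \<open>norm y\<close> of the first substitution
      contributes one more.\<close>
    also have "ennreal ((1 / w s) ^ DIM('b)) * ennreal (1 / w s) = ennreal (1 / w s ^ Suc DIM('b))"
      using w[of s] by (subst ennreal_mult[symmetric]) (auto simp: power_one_over field_simps)
    finally show "(\<integral>\<^sup>+y. ennreal (norm y) * g (s / w s) * indicator (ball 0 1) (w s *\<^sub>R y) \<partial>(lborel :: 'b measure))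
      = K * (g (s / w s) * ennreal (1 / w s ^ Suc DIM('b)))" .
  qed
  finally show ?thesis by (simp add: G_def w_def)
qed

text \<open>With t = pi/2 - arctan s, so that s = cot t, this is the integral of
  \<open>cos (n t) sin^2 t\<close> over [0, pi]. The proof applies the fundamental theorem of
  calculus in the variable s over the whole line.\<close>

lemma has_bochner_integral_cos_arctan:
  fixes n :: nat
  defines "f \<equiv> \<lambda>s. cos (real n * (pi / 2 - arctan s)) / (1 + s\<^sup>2)\<^sup>2"
  shows "has_bochner_integral lborel f ((if n = 0 then pi / 2 else 0) - (if n = 2 then pi / 4 else 0))"
proof -
  \<comment> \<open>the angle of \<open>(s + \<i>) / sqrt (1 + s^2)\<close>, so that \<open>sin^2 = 1 / (1 + s^2)\<close>\<close>
  define \<theta> where "\<theta> s = pi / 2 - arctan s" for s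
  \<comment> \<open>An antiderivative of \<open>cos (k t)\<close> vanishing at 0. The separate value
    at \<open>k = 0\<close> lets one formula \<open>H\<close> also cover the frequencies 0 and 2,
    where a resonance occurs.\<close>
  define S where "S k t = (if k = 0 then t else sin (k * t) / k)" for k t :: real
  define H where "H m t = S m t / 2 - S (m + 2) t / 4 - S (m - 2) t / 4" for m t :: real
  have S: "(S k has_real_derivative cos (k * t)) (at t)" for k t
    unfolding S_def by (cases "k = 0") (auto intro!: derivative_eq_intros)
  have cos_sin: "cos (m * t) / 2 - cos ((m + 2) * t) / 4 - cos ((m - 2) * t) / 4
      = cos (m * t) * (sin t)\<^sup>2" for m t :: real
    by (simp add: ring_distribs cos_add cos_diff cos_double sin_squared_eq) (simp add: field_simps)
  have H: "(H m has_real_derivative cos (m * t) * (sin t)\<^sup>2) (at t)" for m t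
    unfolding H_def[abs_def] cos_sin[symmetric]
    by (intro DERIV_diff DERIV_cdivide S)
  have sin_\<theta>: "(sin (\<theta> s))\<^sup>2 = 1 / (1 + s\<^sup>2)" for s
    by (simp add: \<theta>_def sin_diff cos_arctan power_divide add_nonneg_nonneg)
  have F: "((\<lambda>s. - H m (\<theta> s)) has_real_derivative cos (m * \<theta> s) / (1 + s\<^sup>2)\<^sup>2) (at s)" for m s
  proof -
    have "(\<theta> has_real_derivative - inverse (1 + s\<^sup>2)) (at s)"
      unfolding \<theta>_def[abs_def] by (auto intro!: derivative_eq_intros)
    from DERIV_minus[OF DERIV_chain'[OF this H[of m]]]
    show ?thesis unfolding sin_\<theta> by (simp add: power2_eq_square divide_inverse mult.assoc)
  qed
  have H0: "H m 0 = 0" for m by (simp add: H_def S_def)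
  have H_cont: "isCont (H m) t" for m t using H DERIV_isCont by blast
  have lim_top: "((\<lambda>s. - H m (\<theta> s)) \<longlongrightarrow> 0) at_top" for m
  proof -
    have "(\<theta> \<longlongrightarrow> pi / 2 - pi / 2) at_top"
      unfolding \<theta>_def[abs_def] by (intro tendsto_intros tendsto_arctan_at_top)
    then have "((\<lambda>s. - H m (\<theta> s)) \<longlongrightarrow> - H m 0) at_top"
      by (intro tendsto_minus isCont_tendsto_compose[OF H_cont]) simp
    then show ?thesis by (simp add: H0)
  qed
  have lim_bot: "((\<lambda>s. - H m (\<theta> s)) \<longlongrightarrow> - H m pi) at_bot" for m
  proof -
    have "(\<theta> \<longlongrightarrow> pi / 2 - - (pi / 2)) at_bot"
      unfolding \<theta>_def[abs_def] by (intro tendsto_intros tendsto_arctan_at_bot)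
    then show ?thesis
      by (intro tendsto_minus isCont_tendsto_compose[OF H_cont]) simp
  qed
  have pos: "0 < 1 + s\<^sup>2" for s :: real by (simp add: add_pos_nonneg)
  have cont: "isCont (\<lambda>s. cos (m * \<theta> s) / (1 + s\<^sup>2)\<^sup>2) s" for m s
    using pos[of s] unfolding \<theta>_def
    by (intro continuous_intros) auto
  \<comment> \<open>For frequency 0 the integrand is nonnegative, so the fundamental theorem yields
    integrability as well; this integrand then dominates all the others.\<close>
  have "set_integrable lborel (einterval (-\<infinity>) \<infinity>) (\<lambda>s. cos (0 * \<theta> s) / (1 + s\<^sup>2)\<^sup>2)"
    by (rule interval_integral_FTC_nonneg[where F = "\<lambda>s. - H 0 (\<theta> s)" and A = "- H 0 pi" and B = 0])
      (use F[of 0] cont[where m = 0] lim_top[of 0] lim_bot[of 0] in \<open>auto simp: ereal_tendsto_simps\<close>)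
  then have int0: "integrable lborel (\<lambda>s::real. 1 / (1 + s\<^sup>2)\<^sup>2)"
    by (simp add: set_integrable_def)
  have int: "integrable lborel f"
  proof (rule Bochner_Integration.integrable_bound[OF int0])
    show "f \<in> borel_measurable lborel" unfolding f_def by measurable
    show "AE s in lborel. norm (f s) \<le> norm (1 / (1 + s\<^sup>2)\<^sup>2)"
      by (simp add: f_def divide_right_mono)
  qed
  have "(LBINT s=-\<infinity>..\<infinity>. f s) = 0 - (- H (real n) pi)"
    using int F[of "real n"] cont[where m = "real n"] lim_top[of "real n"] lim_bot[of "real n"]
    by (intro interval_integral_FTC_integrable[where F = "\<lambda>s. - H (real n) (\<theta> s)"])
      (auto simp: ereal_tendsto_simps has_real_derivative_iff_has_vector_derivative f_def \<theta>_def
        set_integrable_def)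
  then have "integral\<^sup>L lborel f = H (real n) pi"
    by (simp add: interval_lebesgue_integral_def set_lebesgue_integral_def)
  also have "\<dots> = (if n = 0 then pi / 2 else 0) - (if n = 2 then pi / 4 else 0)"
  proof -
    \<comment> \<open>Since sin vanishes at integer multiples of pi, only a zero frequency among n,
      n + 2 and n - 2 contributes; n + 2 never does.\<close>
    have "S (real_of_int k) pi = (if k = 0 then pi else 0)" for k
      by (simp add: S_def sin_zero_iff_int2 mult.commute)
    from this[of "int n"] this[of "int n + 2"] this[of "int n - 2"]
    show ?thesis by (auto simp: H_def)
  qed
  finally show ?thesis using int by (simp add: has_bochner_integral_iff)
qed

text \<open>The ambient ball has dimension 4 and the fiber dimension 3, which gives the exponent.
  The factor 2/pi comes from total mass one: taking \<open>g\<close> constant forces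
  \<open>K * (pi / 2) = 1\<close>.\<close>

lemma nn_integral_sphere3_fst:
  fixes g :: "real \<Rightarrow> ennreal"
  assumes [measurable]: "g \<in> borel_measurable borel"
  shows "(\<integral>\<^sup>+x. g (fst x) \<partial>sphere3)
    = (\<integral>\<^sup>+s. g (s / sqrt (1 + s\<^sup>2)) * ennreal (2 / pi / (1 + s\<^sup>2)\<^sup>2) \<partial>lborel)"
proof -
  let ?U = "emeasure lborel (ball (0::quat) 1)"
  define N where "N = (\<integral>\<^sup>+y. ennreal (norm y) * indicator (ball 0 1) y \<partial>(lborel :: (real \<times> real \<times> real) measure))"
  define K where "K = N / ?U"
  define d :: "real \<Rightarrow> ennreal" where "d s = ennreal (1 / (1 + s\<^sup>2)\<^sup>2)" for s
  have [measurable]: "d \<in> borel_measurable borel" unfolding d_def by measurable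
  have [measurable]: "(\<lambda>x. fst (sgn x)) \<in> borel_measurable (borel :: quat measure)"
    by (rule measurable_compose[OF borel_measurable_sgn]) measurable
  have sqrt4: "sqrt (1 + s\<^sup>2) ^ Suc (Suc (Suc (Suc 0))) = (1 + s\<^sup>2)\<^sup>2" for s :: real
  proof -
    have "sqrt (1 + s\<^sup>2) ^ Suc (Suc (Suc (Suc 0))) = ((sqrt (1 + s\<^sup>2))\<^sup>2)\<^sup>2"
      by (simp only: power2_eq_square power_Suc power_0 mult_1_right mult.assoc)
    then show ?thesis by (simp add: add_nonneg_nonneg)
  qed
  have main: "(\<integral>\<^sup>+x. h (fst x) \<partial>sphere3) = K * (\<integral>\<^sup>+s. h (s / sqrt (1 + s\<^sup>2)) * d s \<partial>lborel)"
    if [measurable]: "h \<in> borel_measurable borel" for h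
  proof -
    have "(\<integral>\<^sup>+x. h (fst x) \<partial>sphere3) = (\<integral>\<^sup>+x. h (fst (sgn x)) * indicator (ball 0 1) x \<partial>(lborel :: quat measure)) / ?U"
      unfolding sphere3_def by (subst nn_integral_distr) (simp_all add: nn_integral_uniform_measure)
    also have "\<dots> = (N * (\<integral>\<^sup>+s. h (s / sqrt (1 + s\<^sup>2)) * d s \<partial>lborel)) / ?U"
      unfolding nn_integral_ball_fst_sgn[OF that] N_def[symmetric]
      by (subst nn_integral_cmult) (simp_all add: d_def sqrt4 del: power_Suc)
    finally show ?thesis
      by (simp only: K_def mult.commute[of N] mult.commute[of "N / ?U"] ennreal_times_divide)
  qed
  have "(\<integral>\<^sup>+s. d s \<partial>lborel) = ennreal (pi / 2)"
    using has_bochner_integral_cos_arctan[of 0]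
    by (simp add: d_def has_bochner_integral_iff nn_integral_eq_integral)
  moreover have "K * (\<integral>\<^sup>+s. d s \<partial>lborel) = 1"
    using main[of "\<lambda>_. 1"] sphere3.emeasure_space_1 by simp
  ultimately have "K * ennreal (pi / 2) = 1" by simp
  have "K = K * (ennreal (pi / 2) * ennreal (2 / pi))"
    by (subst ennreal_mult[symmetric]) auto
  also have "\<dots> = ennreal (2 / pi)"
    using \<open>K * ennreal (pi / 2) = 1\<close> by (simp flip: mult.assoc)
  finally have "K = ennreal (2 / pi)" .
  moreover have "ennreal (2 / pi) * (h * d s) = h * ennreal (2 / pi / (1 + s\<^sup>2)\<^sup>2)" for s h
    by (subst mult.left_commute) (simp add: d_def flip: ennreal_mult)
  ultimately show ?thesis
    by (simp add: main[OF assms] flip: nn_integral_cmult)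
qed

text \<open>The radial projection misses the sphere only at the origin, where
  \<open>sgn 0 = 0\<close>, and this is a null set.\<close>

lemma AE_sphere3_norm: "AE x in sphere3. norm x = 1"
proof -
  have "AE x in uniform_measure lborel (ball (0::quat) 1). norm (sgn x) = 1"
    using AE_lborel_singleton[of "0::quat"]
    by (intro AE_uniform_measureI) (auto simp: norm_sgn)
  then show ?thesis
    unfolding sphere3_def by (subst AE_distr_iff) auto
qed

text \<open>Used to discard the zeros of the polynomials: avoiding one real part keeps
  \<open>slice x\<close> away from both \<open>a\<close> and \<open>cnj a\<close>. The level set is
  null because \<open>s / sqrt (1 + s^2) = sin (arctan s)\<close> is injective in
  \<open>s\<close>.\<close>

lemma AE_sphere3_fst_neq: "AE x in sphere3. fst x \<noteq> c"
proof -
  have "(\<integral>\<^sup>+x. indicator {c} (fst x) \<partial>sphere3)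
      = (\<integral>\<^sup>+s. indicator {c} (s / sqrt (1 + s\<^sup>2)) * ennreal (2 / pi / (1 + s\<^sup>2)\<^sup>2) \<partial>lborel)"
    by (rule nn_integral_sphere3_fst) simp
  also have "\<dots> = (\<integral>\<^sup>+s. 0 \<partial>(lborel :: real measure))"
  proof (rule nn_integral_cong_AE, use AE_lborel_singleton[of "tan (arcsin c)"] in eventually_elim)
    fix s :: real assume s: "s \<noteq> tan (arcsin c)"
    have "s / sqrt (1 + s\<^sup>2) \<noteq> c"
    proof
      assume "s / sqrt (1 + s\<^sup>2) = c"
      then have "sin (arctan s) = c" by (simp add: sin_arctan)
      then have "arcsin c = arctan s"
        using arctan_bounded[of s] by (auto intro!: arcsin_sin)
      with s show False by (simp add: tan_arctan)
    qed
    then show "indicator {c} (s / sqrt (1 + s\<^sup>2)) * ennreal (2 / pi / (1 + s\<^sup>2)\<^sup>2) = 0" by simp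
  qed
  finally have "AE x in sphere3. indicator {c} (fst x) = (0 :: ennreal)"
    by (simp add: nn_integral_0_iff_AE)
  then show ?thesis by eventually_elim (auto simp: indicator_def split: if_splits)
qed

section \<open>The slice map and its moments\<close>

definition slice :: "quat \<Rightarrow> complex" where
  "slice x = Complex (fst x) (norm (snd x))"

lemma cmod_slice: "cmod (slice x) = norm x"
  by (cases x) (simp add: slice_def cmod_def norm_Pair)

lemma borel_measurable_slice[measurable]: "slice \<in> borel_measurable borel"
  unfolding slice_def[abs_def] Complex_eq
  by (intro borel_measurable_continuous_onI continuous_intros)

text \<open>On the sphere \<open>slice x\<close> is the point of the upper half circle with real
  part \<open>fst x\<close>, so the law of \<open>fst\<close> determines everything. In the
  coordinate s this point is \<open>cis (pi / 2 - arctan s)\<close>, and De Moivre turns its powers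
  into cosines.\<close>

lemma has_bochner_integral_slice_power:
  "has_bochner_integral sphere3 (\<lambda>x. Re (slice x ^ n))
     ((if n = 0 then 1 else 0) - (if n = 2 then 1 / 2 else 0))"
proof -
  define D :: "real \<Rightarrow> real" where "D s = 2 / pi / (1 + s\<^sup>2)\<^sup>2" for s
  define p :: "real \<Rightarrow> real" where "p s = s / sqrt (1 + s\<^sup>2)" for s
  \<comment> \<open>Lifts a real part in [-1, 1] to the upper half circle; what it does elsewhere is
    irrelevant, as \<open>fst\<close> takes values in [-1, 1] almost everywhere.\<close>
  define u where "u t = complex_of_real t + \<i> * complex_of_real (sqrt (1 - t\<^sup>2))" for t
  have [measurable]: "D \<in> borel_measurable borel" "p \<in> borel_measurable borel" "u \<in> borel_measurable borel"
    unfolding D_def p_def u_def by measurable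
  have D: "D s \<ge> 0" for s by (simp add: D_def)
  \<comment> \<open>The integral formula so far covers nonnegative functions; applied to indicators
    it identifies the law of \<open>fst\<close>, and signed integrands can then be
    transferred.\<close>
  have distr: "distr sphere3 borel fst = distr (density lborel D) borel p"
  proof (rule measure_eqI)
    fix A assume "A \<in> sets (distr sphere3 borel fst)"
    then have [measurable]: "A \<in> sets borel" by simp
    have "emeasure (distr sphere3 borel fst) A = (\<integral>\<^sup>+x. indicator A (fst x) \<partial>sphere3)"
      by (subst nn_integral_indicator[symmetric], simp, subst nn_integral_distr) simp_all
    also have "\<dots> = (\<integral>\<^sup>+s. indicator A (p s) * ennreal (D s) \<partial>lborel)"
      unfolding p_def D_def by (rule nn_integral_sphere3_fst) simp
    also have "\<dots> = (\<integral>\<^sup>+s. indicator A (p s) \<partial>density lborel D)"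
      by (simp add: nn_integral_density mult.commute)
    also have "\<dots> = emeasure (distr (density lborel D) borel p) A"
      by (subst nn_integral_indicator[symmetric], simp, subst nn_integral_distr) simp_all
    finally show "emeasure (distr sphere3 borel fst) A = emeasure (distr (density lborel D) borel p) A" .
  qed simp
  have u: "Re (u (p s) ^ n) = cos (real n * (pi / 2 - arctan s))" for s
  proof -
    have "1 - (p s)\<^sup>2 = (1 / sqrt (1 + s\<^sup>2))\<^sup>2"
      by (simp add: p_def power_divide add_nonneg_nonneg field_simps add_pos_nonneg
          add_pos_nonneg[THEN less_imp_neq[symmetric]])
    then have "u (p s) = cis (pi / 2 - arctan s)"
      by (simp add: u_def p_def complex_eq_iff sin_diff cos_diff
          sin_arctan cos_arctan real_sqrt_divide)
    then show ?thesis by (simp add: Complex.DeMoivre)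
  qed
  have "has_bochner_integral lborel (\<lambda>s. 2 / pi * (cos (real n * (pi / 2 - arctan s)) / (1 + s\<^sup>2)\<^sup>2))
      (2 / pi * ((if n = 0 then pi / 2 else 0) - (if n = 2 then pi / 4 else 0)))"
    by (intro has_bochner_integral_mult_right has_bochner_integral_cos_arctan)
  also have "(\<lambda>s. 2 / pi * (cos (real n * (pi / 2 - arctan s)) / (1 + s\<^sup>2)\<^sup>2))
      = (\<lambda>s. D s *\<^sub>R Re (u (p s) ^ n))"
    by (simp add: u D_def)
  finally have "has_bochner_integral (density lborel D) (\<lambda>s. Re (u (p s) ^ n))
      (2 / pi * ((if n = 0 then pi / 2 else 0) - (if n = 2 then pi / 4 else 0)))"
    using D by (intro has_bochner_integral_density) simp_all
  then have "has_bochner_integral (distr sphere3 borel fst) (\<lambda>t. Re (u t ^ n))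
      (2 / pi * ((if n = 0 then pi / 2 else 0) - (if n = 2 then pi / 4 else 0)))"
    unfolding distr by (intro has_bochner_integral_distr) simp_all
  then have "has_bochner_integral sphere3 (\<lambda>x. Re (u (fst x) ^ n))
      (2 / pi * ((if n = 0 then pi / 2 else 0) - (if n = 2 then pi / 4 else 0)))"
    by (simp add: has_bochner_integral_iff integrable_distr_eq integral_distr)
  moreover have "AE x in sphere3. Re (u (fst x) ^ n) = Re (slice x ^ n)"
    using AE_sphere3_norm
  proof eventually_elim
    fix x :: quat assume "norm x = 1"
    then have "(fst x)\<^sup>2 + (norm (snd x))\<^sup>2 = 1"
      using cmod_slice[of x] by (simp add: cmod_def slice_def)
    then have "sqrt (1 - (fst x)\<^sup>2) = norm (snd x)"
      by (intro real_sqrt_unique) auto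
    then show "Re (u (fst x) ^ n) = Re (slice x ^ n)"
      by (simp add: u_def slice_def Complex_eq)
  qed
  ultimately have "has_bochner_integral sphere3 (\<lambda>x. Re (slice x ^ n))
      (2 / pi * ((if n = 0 then pi / 2 else 0) - (if n = 2 then pi / 4 else 0)))"
    by (subst (asm) has_bochner_integral_cong_AE) auto
  also have "2 / pi * ((if n = 0 then pi / 2 else 0) - (if n = 2 then pi / 4 else 0))
      = (if n = 0 then 1 else 0) - (if n = 2 then 1 / 2 else (0::real))"
    by (auto simp: field_simps)
  finally show ?thesis .
qed

subsection \<open>Logarithmic integrals\<close>

text \<open>The logarithm of |x^2 - 2 Re(a) x + |a|^2| away from its zeros. As a sum of two
  logarithms it is, for real \<open>a\<close>, twice a single logarithm at every point, without
  exceptions caused by \<open>ln 0\<close>.\<close>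

definition ln_conj_dist :: "complex \<Rightarrow> quat \<Rightarrow> real" where
  "ln_conj_dist a x = ln (cmod (slice x - a)) + ln (cmod (slice x - cnj a))"

lemma borel_measurable_ln_conj_dist[measurable]: "ln_conj_dist a \<in> borel_measurable borel"
  unfolding ln_conj_dist_def[abs_def] by measurable

text \<open>On |z| = 1 one has \<open>z - b = z * (1 - b * cnj z)\<close>, so the logarithm is the
  real part of the power series of \<open>Ln (1 - w)\<close> at \<open>w = b * cnj z\<close>. Adding
  the series for \<open>a\<close> and \<open>cnj a\<close> cancels the products of imaginary parts.
  The term n = 0 is 0 by the convention on division by zero.\<close>

lemma ln_conj_dist_sums:
  assumes "cmod a < 1" "norm x = 1"
  shows "(\<lambda>n. - 2 * Re (a ^ n) / n * Re (slice x ^ n)) sums ln_conj_dist a x"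
proof -
  define z where "z = slice x"
  have z: "cmod z = 1" by (simp add: z_def cmod_slice assms)
  then have zz: "z * cnj z = 1" by (simp add: complex_norm_square[symmetric])
  have "(\<lambda>n. - Re ((b * cnj z) ^ n) / n) sums ln (cmod (z - b))" if "cmod b < 1" for b
  proof -
    have less: "cmod (b * cnj z) < 1" using that z by (simp add: norm_mult)
    then have neq: "1 - b * cnj z \<noteq> 0" by auto
    have "(\<lambda>n. - ((b * cnj z) ^ n) / of_nat n) sums Ln (1 - b * cnj z)"
      using Ln_series'[of "- (b * cnj z)"] less by simp
    from sums_Re[OF this]
    have "(\<lambda>n. - Re ((b * cnj z) ^ n) / n) sums ln (cmod (1 - b * cnj z))"
      using neq by (simp add: Re_divide_of_nat)
    moreover have "z - b = z * (1 - b * cnj z)"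
      by (simp add: algebra_simps) (metis mult.commute mult.right_neutral zz mult.assoc)
    then have "cmod (z - b) = cmod (1 - b * cnj z)"
      using z by (simp add: norm_mult)
    ultimately show ?thesis by simp
  qed
  from sums_add[OF this[of a] this[of "cnj a"]]
  have "(\<lambda>n. - Re ((a * cnj z) ^ n) / n + - Re ((cnj a * cnj z) ^ n) / n) sums ln_conj_dist a x"
    using assms by (simp add: ln_conj_dist_def z_def)
  also have "(\<lambda>n. - Re ((a * cnj z) ^ n) / n + - Re ((cnj a * cnj z) ^ n) / n)
      = (\<lambda>n. - 2 * Re (a ^ n) / n * Re (z ^ n))"
    by (simp add: power_mult_distrib mult.assoc flip: complex_cnj_power add_divide_distrib)
  finally show ?thesis by (simp add: z_def)
qed

text \<open>Termwise integration is justified by the majorant \<open>2 * cmod a ^ n\<close>,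
  summable because |a| < 1.\<close>

lemma has_bochner_integral_ln_conj_dist_lt_1:
  assumes a: "cmod a < 1"
  shows "has_bochner_integral sphere3 (ln_conj_dist a) (Re (a\<^sup>2) / 2)"
proof -
  define f where "f n x = - 2 * Re (a ^ n) / n * Re (slice x ^ n)" for n x
  have int: "has_bochner_integral sphere3 (f n)
      (- 2 * Re (a ^ n) / n * ((if n = 0 then 1 else 0) - (if n = 2 then 1 / 2 else 0)))" for n
    unfolding f_def[abs_def]
    by (intro has_bochner_integral_mult_right has_bochner_integral_slice_power)
  also have "- 2 * Re (a ^ n) / n * ((if n = 0 then 1 else 0) - (if n = 2 then 1 / 2 else 0))
      = (if n = 2 then Re (a\<^sup>2) / 2 else 0)" for n :: nat
    by auto
  finally have int: "has_bochner_integral sphere3 (f n) (if n = 2 then Re (a\<^sup>2) / 2 else 0)" for n .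
  have bound: "norm (f n x) \<le> 2 * cmod a ^ n" if "norm x = 1" for n x
  proof (cases "n = 0")
    case False
    have "\<bar>Re (a ^ n)\<bar> * \<bar>Re (slice x ^ n)\<bar> \<le> cmod a ^ n * 1"
      using abs_Re_le_cmod[of "a ^ n"] abs_Re_le_cmod[of "slice x ^ n"] that
      by (intro mult_mono) (auto simp: norm_power cmod_slice)
    moreover have "\<dots> \<le> cmod a ^ n * n"
      using False by (intro mult_left_mono) auto
    ultimately show ?thesis
      using False by (simp add: f_def abs_mult field_simps)
  qed (simp add: f_def)
  have geo: "summable (\<lambda>n. 2 * cmod a ^ n)"
    using a by (intro summable_mult summable_geometric) simp
  have int_f: "integrable sphere3 (f n)" for n
    using int by (simp add: has_bochner_integral_iff)
  have sum_AE: "AE x in sphere3. summable (\<lambda>n. norm (f n x))"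
    using AE_sphere3_norm
    by eventually_elim (rule summable_comparison_test'[OF geo], use bound in auto)
  have "norm (\<integral>x. norm (f n x) \<partial>sphere3) \<le> 2 * cmod a ^ n" for n
  proof -
    have "(\<integral>x. norm (f n x) \<partial>sphere3) \<le> (\<integral>x. 2 * cmod a ^ n \<partial>sphere3)"
      using AE_sphere3_norm int_f
      by (intro integral_mono_AE) (auto elim!: eventually_mono intro: bound[unfolded real_norm_def])
    then show ?thesis by simp
  qed
  then have sum_int: "summable (\<lambda>n. \<integral>x. norm (f n x) \<partial>sphere3)"
    by (rule summable_comparison_test'[OF geo])
  have "has_bochner_integral sphere3 (\<lambda>x. \<Sum>n. f n x) (\<Sum>n. integral\<^sup>L sphere3 (f n))"
    using integrable_suminf[OF int_f sum_AE sum_int] integral_suminf[OF int_f sum_AE sum_int]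
    by (simp add: has_bochner_integral_iff)
  also have "(\<lambda>n. integral\<^sup>L sphere3 (f n)) = (\<lambda>n. if n = 2 then Re (a\<^sup>2) / 2 else 0)"
    using int by (simp add: has_bochner_integral_iff)
  also have "(\<Sum>n. if n = 2 then Re (a\<^sup>2) / 2 else 0) = Re (a\<^sup>2) / 2"
    using sums_single[of 2 "\<lambda>_. Re (a\<^sup>2) / 2"] by (simp add: sums_iff)
  finally have "has_bochner_integral sphere3 (\<lambda>x. \<Sum>n. f n x) (Re (a\<^sup>2) / 2)" .
  moreover have "AE x in sphere3. (\<Sum>n. f n x) = ln_conj_dist a x"
    using AE_sphere3_norm
    by eventually_elim (use ln_conj_dist_sums[OF a] in \<open>simp add: f_def sums_iff\<close>)
  ultimately show ?thesis
    using int_f by (subst (asm) has_bochner_integral_cong_AE) auto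
qed

text \<open>Bounds uniform in \<open>r\<close>. Above, |z - rb| is at most 1 + r. Below, 1 - r is at
  most |z - rb|, so |z - b| is at most |z - rb| + (1 - r) and hence at most twice |z - rb|.\<close>

lemma ln_cmod_diff_scaled:
  assumes "cmod z = 1" "cmod b = 1" "z \<noteq> b" "0 \<le> r" "r < 1"
  shows "ln (cmod (z - of_real r * b)) \<le> ln 2"
    and "ln (cmod (z - b)) - ln 2 \<le> ln (cmod (z - of_real r * b))"
proof -
  have rb: "cmod (of_real r * b) = r" using assms by (simp add: norm_mult)
  have pos: "1 - r \<le> cmod (z - of_real r * b)"
    using norm_triangle_ineq2[of z "of_real r * b"] assms rb by simp
  show "ln (cmod (z - of_real r * b)) \<le> ln 2"
    using norm_triangle_ineq4[of z "of_real r * b"] assms rb pos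
    by (intro ln_mono) linarith+
  have "cmod (of_real r * b - b) = 1 - r"
  proof -
    have "of_real r * b - b = of_real (r - 1) * b" by (simp add: algebra_simps)
    then show ?thesis using assms by (simp only: norm_mult norm_of_real) simp
  qed
  then have "cmod (z - b) \<le> 2 * cmod (z - of_real r * b)"
    using norm_triangle_ineq[of "z - of_real r * b" "of_real r * b - b"] pos by simp
  then have "ln (cmod (z - b)) \<le> ln (2 * cmod (z - of_real r * b))"
    using assms by (intro ln_mono) auto
  also have "\<dots> = ln 2 + ln (cmod (z - of_real r * b))"
    using pos assms by (intro ln_mult_pos) auto
  finally show "ln (cmod (z - b)) - ln 2 \<le> ln (cmod (z - of_real r * b))" by simp
qed

lemma AE_slice_neq: "AE x in sphere3. slice x \<noteq> a \<and> slice x \<noteq> cnj a"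
  using AE_sphere3_fst_neq[of "Re a"] by eventually_elim (auto simp: slice_def complex_eq_iff)

lemma has_bochner_integral_ln_conj_dist_eq_1:
  assumes a: "cmod a = 1"
  shows "has_bochner_integral sphere3 (ln_conj_dist a) (Re (a\<^sup>2) / 2)"
proof -
  define r where "r k = 1 - inverse (real (Suc k))" for k
  have r: "0 \<le> r k" "r k < 1" for k by (simp_all add: r_def field_simps)
  have r_lim: "r \<longlonglongrightarrow> 1"
    unfolding r_def[abs_def] using tendsto_diff[OF tendsto_const LIMSEQ_inverse_real_of_nat, of 1] by simp
  define L where "L k = ln_conj_dist (of_real (r k) * a)" for k
  have [measurable]: "L k \<in> borel_measurable borel" for k unfolding L_def by measurable
  have L: "has_bochner_integral sphere3 (L k) ((r k)\<^sup>2 * (Re (a\<^sup>2) / 2))" for k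
    using has_bochner_integral_ln_conj_dist_lt_1[of "of_real (r k) * a"] r[of k] a
    by (simp add: L_def norm_mult power_mult_distrib flip: of_real_power)
  have bound: "AE x in sphere3. \<forall>k. L k x \<le> 2 * ln 2 \<and> ln_conj_dist a x - 2 * ln 2 \<le> L k x"
    using AE_sphere3_norm AE_slice_neq[of a]
  proof eventually_elim
    fix x assume x: "norm x = 1" "slice x \<noteq> a \<and> slice x \<noteq> cnj a"
    show "\<forall>k. L k x \<le> 2 * ln 2 \<and> ln_conj_dist a x - 2 * ln 2 \<le> L k x"
    proof
      fix k
      show "L k x \<le> 2 * ln 2 \<and> ln_conj_dist a x - 2 * ln 2 \<le> L k x"
        using ln_cmod_diff_scaled[of "slice x" a "r k"] ln_cmod_diff_scaled[of "slice x" "cnj a" "r k"] x a r[of k]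
        by (auto simp: L_def ln_conj_dist_def cmod_slice)
    qed
  qed
  have lim: "AE x in sphere3. (\<lambda>k. L k x) \<longlonglongrightarrow> ln_conj_dist a x"
    using AE_slice_neq[of a]
  proof eventually_elim
    fix x assume x: "slice x \<noteq> a \<and> slice x \<noteq> cnj a"
    have "(\<lambda>k. ln (cmod (slice x - of_real (r k) * b))) \<longlonglongrightarrow> ln (cmod (slice x - of_real 1 * b))"
      if "slice x \<noteq> b" for b
      using that r_lim by (intro tendsto_intros) auto
    from tendsto_add[OF this[of a] this[of "cnj a"]]
    show "(\<lambda>k. L k x) \<longlonglongrightarrow> ln_conj_dist a x"
      using x by (simp add: L_def ln_conj_dist_def)
  qed
  \<comment> \<open>The majorant for dominated convergence will contain the limit function, so its
    integrability has to come first. The uniform upper bound makes \<open>2 * ln 2 - L k\<close>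
    nonnegative, as Fatou requires.\<close>
  have "integrable sphere3 (\<lambda>x. 2 * ln 2 - ln_conj_dist a x)"
  proof (rule integrableI_nonneg)
    show "AE x in sphere3. 0 \<le> 2 * ln 2 - ln_conj_dist a x"
      using bound lim
      by eventually_elim (auto intro: LIMSEQ_le_const2)
    have "(\<integral>\<^sup>+x. ennreal (2 * ln 2 - ln_conj_dist a x) \<partial>sphere3)
        = (\<integral>\<^sup>+x. liminf (\<lambda>k. ennreal (2 * ln 2 - L k x)) \<partial>sphere3)"
    proof (rule nn_integral_cong_AE, use lim in eventually_elim)
      fix x assume "(\<lambda>k. L k x) \<longlonglongrightarrow> ln_conj_dist a x"
      then have "(\<lambda>k. ennreal (2 * ln 2 - L k x)) \<longlonglongrightarrow> ennreal (2 * ln 2 - ln_conj_dist a x)"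
        by (intro tendsto_intros)
      then show "ennreal (2 * ln 2 - ln_conj_dist a x) = liminf (\<lambda>k. ennreal (2 * ln 2 - L k x))"
        by (intro lim_imp_Liminf[symmetric]) simp_all
    qed
    also have "\<dots> \<le> liminf (\<lambda>k. \<integral>\<^sup>+x. ennreal (2 * ln 2 - L k x) \<partial>sphere3)"
      by (intro nn_integral_liminf) measurable
    also have "\<dots> \<le> liminf (\<lambda>k. ennreal (2 * ln 2 + 1 / 2))"
    proof (intro Liminf_mono always_eventually allI)
      fix k
      have "(\<integral>\<^sup>+x. ennreal (2 * ln 2 - L k x) \<partial>sphere3) = ennreal (\<integral>x. 2 * ln 2 - L k x \<partial>sphere3)"
        using L[of k] bound
        by (intro nn_integral_eq_integral) (auto simp: has_bochner_integral_iff elim!: eventually_mono)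
      also have "(\<integral>x. 2 * ln 2 - L k x \<partial>sphere3) = 2 * ln 2 - (r k)\<^sup>2 * (Re (a\<^sup>2) / 2)"
        using L[of k] by (simp add: has_bochner_integral_iff)
      also have "\<dots> \<le> 2 * ln 2 + 1 / 2"
      proof -
        have "\<bar>(r k)\<^sup>2 * Re (a\<^sup>2)\<bar> \<le> 1 * 1"
          unfolding abs_mult using r[of k] a abs_Re_le_cmod[of "a\<^sup>2"]
          by (intro mult_mono) (auto simp: norm_power power_le_one)
        then show ?thesis by simp
      qed
      finally show "(\<integral>\<^sup>+x. ennreal (2 * ln 2 - L k x) \<partial>sphere3) \<le> ennreal (2 * ln 2 + 1 / 2)"
        by (simp add: ennreal_leI)
    qed
    also have "\<dots> = ennreal (2 * ln 2 + 1 / 2)"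
      by (simp add: Liminf_const)
    also have "\<dots> < \<infinity>" by (simp only: infinity_ennreal_def ennreal_less_top)
    finally show "(\<integral>\<^sup>+x. ennreal (2 * ln 2 - ln_conj_dist a x) \<partial>sphere3) < \<infinity>" .
  qed simp
  from Bochner_Integration.integrable_diff[OF sphere3.integrable_const[of "2 * ln 2"] this]
  have int: "integrable sphere3 (ln_conj_dist a)" by simp
  have "(\<lambda>k. integral\<^sup>L sphere3 (L k)) \<longlonglongrightarrow> integral\<^sup>L sphere3 (ln_conj_dist a)"
  \<comment> \<open>The lower bound for \<open>L k\<close> gives
    \<open>2 * ln 2 - ln_conj_dist a x\<close>; the further \<open>2 * ln 2\<close> makes the
    majorant cover the upper bound too, since the limit is itself at most
    \<open>2 * ln 2\<close>.\<close>
  proof (rule integral_dominated_convergence[where w = "\<lambda>x. 4 * ln 2 - ln_conj_dist a x"])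
    show "AE x in sphere3. norm (L k x) \<le> 4 * ln 2 - ln_conj_dist a x" for k
      using bound lim
    proof eventually_elim
      fix x assume b: "\<forall>k. L k x \<le> 2 * ln 2 \<and> ln_conj_dist a x - 2 * ln 2 \<le> L k x"
        and "(\<lambda>k. L k x) \<longlonglongrightarrow> ln_conj_dist a x"
      then have "ln_conj_dist a x \<le> 2 * ln 2" by (auto intro: LIMSEQ_le_const2)
      moreover have "0 \<le> ln (2 :: real)" by simp
      ultimately show "norm (L k x) \<le> 4 * ln 2 - ln_conj_dist a x"
        unfolding real_norm_def using b[rule_format, of k] by linarith
    qed
  qed (use int lim in simp_all)
  moreover have "(\<lambda>k. integral\<^sup>L sphere3 (L k)) \<longlonglongrightarrow> 1\<^sup>2 * (Re (a\<^sup>2) / 2)"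
    unfolding has_bochner_integral_integral_eq[OF L]
    by (intro tendsto_mult tendsto_power r_lim tendsto_const)
  ultimately have "integral\<^sup>L sphere3 (ln_conj_dist a) = Re (a\<^sup>2) / 2"
    using LIMSEQ_unique by fastforce
  with int show ?thesis by (simp add: has_bochner_integral_iff)
qed

lemma has_bochner_integral_ln_conj_dist:
  "has_bochner_integral sphere3 (ln_conj_dist a)
     (if cmod a \<le> 1 then Re (a\<^sup>2) / 2 else 2 * ln (cmod a) + Re (a\<^sup>2) / (2 * cmod a ^ 4))"
proof -
  consider "cmod a < 1" | "cmod a = 1" | "cmod a > 1" by linarith
  then show ?thesis
  proof cases
    case 1
    then show ?thesis using has_bochner_integral_ln_conj_dist_lt_1 by simp
  next
    case 2
    then show ?thesis using has_bochner_integral_ln_conj_dist_eq_1 by simp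
  next
    case 3
    define b where "b = inverse (cnj a)"
    have "a \<noteq> 0" using 3 by auto
    have b: "cmod b < 1" using 3 by (simp add: b_def norm_inverse inverse_less_1_iff)
    have "b = a / of_real ((cmod a)\<^sup>2)"
      using \<open>a \<noteq> 0\<close> unfolding b_def complex_norm_square by (simp add: field_simps)
    then have "b\<^sup>2 = a\<^sup>2 / of_real (cmod a ^ 4)"
      by (simp add: power_divide flip: power_mult of_real_power)
    then have Re_b: "Re (b\<^sup>2) = Re (a\<^sup>2) / cmod a ^ 4"
      by (simp only: Re_divide_of_real)
    \<comment> \<open>On the unit circle \<open>z * cnj (z - c) = 1 - z * cnj c\<close>, and
      factoring out \<open>- cnj c\<close> leaves the distance from \<open>z\<close> to the inverted
      point.\<close>
    have key: "ln (cmod (z - c)) = ln (cmod c) + ln (cmod (z - inverse (cnj c)))"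
      if "cmod z = 1" "cmod c > 1" for z c
    proof -
      have "c \<noteq> 0" using that by auto
      have "z * cnj z = 1" using that by (simp add: complex_norm_square[symmetric])
      have "z * cnj (z - c) = - cnj c * (z - inverse (cnj c))"
        using \<open>c \<noteq> 0\<close> \<open>z * cnj z = 1\<close> by (simp add: algebra_simps)
      then have "cmod (z * cnj (z - c)) = cmod (- cnj c * (z - inverse (cnj c)))" by (rule arg_cong)
      then have "cmod (z - c) = cmod c * cmod (z - inverse (cnj c))"
        using that by (simp only: norm_mult complex_mod_cnj norm_minus_cancel mult_1)
      moreover have "cmod (inverse (cnj c)) < 1"
        using that by (simp add: norm_inverse inverse_less_1_iff)
      then have "z - inverse (cnj c) \<noteq> 0" using that by auto
      ultimately show ?thesis using \<open>c \<noteq> 0\<close> by (simp add: ln_mult_pos)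
    qed
    have "AE x in sphere3. 2 * ln (cmod a) + ln_conj_dist b x = ln_conj_dist a x"
      using AE_sphere3_norm
      by eventually_elim (use key[of _ a] key[of _ "cnj a"] 3 in \<open>simp add: ln_conj_dist_def b_def cmod_slice\<close>)
    moreover have "has_bochner_integral sphere3 (\<lambda>x. 2 * ln (cmod a) + ln_conj_dist b x)
        (2 * ln (cmod a) + Re (b\<^sup>2) / 2)"
      using has_bochner_integral_ln_conj_dist_lt_1[OF b] by (simp add: has_bochner_integral_iff)
    ultimately have "has_bochner_integral sphere3 (ln_conj_dist a) (2 * ln (cmod a) + Re (b\<^sup>2) / 2)"
      by (subst (asm) has_bochner_integral_cong_AE) auto
    then show ?thesis using 3 by (simp add: Re_b mult.commute)
  qed
qed

subsection \<open>Real polynomials on slices\<close>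

text \<open>For a unit vector \<open>v\<close> this is the algebra embedding of the complex numbers
  into the quaternions that sends the imaginary unit to \<open>v\<close>. It fixes real scalars, so
  a real polynomial maps its image into itself.\<close>

definition slice_embed :: "real \<times> real \<times> real \<Rightarrow> complex \<Rightarrow> quat" where
  "slice_embed v z = (Re z, Im z *\<^sub>R v)"

lemma norm_slice_embed: "norm v = 1 \<Longrightarrow> norm (slice_embed v z) = cmod z"
  by (simp add: slice_embed_def norm_Pair cmod_def)

text \<open>The direction is that of the imaginary part; for real x any unit vector serves, and
  \<open>(1, 0, 0)\<close> is an arbitrary choice.\<close>

lemma slice_embed_slice: obtains v where "norm v = 1" "x = slice_embed v (slice x)"
proof (cases "snd x = 0")
  case True
  show ?thesis
    by (rule that[of "(1, 0, 0)"]) (use True in \<open>auto simp: slice_embed_def slice_def norm_Pair prod_eq_iff\<close>)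
next
  case False
  show ?thesis
    by (rule that[of "sgn (snd x)"])
      (use False in \<open>auto simp: slice_embed_def slice_def norm_sgn sgn_div_norm prod_eq_iff\<close>)
qed

lemma slice_embed_sum: "slice_embed v (\<Sum>i\<in>I. f i) = (\<Sum>i\<in>I. slice_embed v (f i))"
  by (simp add: slice_embed_def sum_prod scaleR_sum_left)

lemma slice_embed_of_real_mult: "slice_embed v (of_real r * z) = r *\<^sub>R slice_embed v z"
  by (simp add: slice_embed_def)

lemma slice_embed_of_real: "slice_embed v (of_real r) = qof_real r"
  by (simp add: slice_embed_def qof_real_def zero_prod_def)

lemma slice_embed_diff: "slice_embed v (z - w) = slice_embed v z - slice_embed v w"
  by (simp add: slice_embed_def scaleR_left_diff_distrib)

lemma slice_embed_add: "slice_embed v (z + w) = slice_embed v z + slice_embed v w"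
  by (simp add: slice_embed_def scaleR_left_distrib)

text \<open>A purely imaginary unit quaternion squares to -1: the cross product of \<open>v\<close>
  with itself vanishes and the scalar part is \<open>- Im z * Im w * (norm v)^2\<close>.\<close>

lemma qmul_slice_embed:
  assumes "norm v = 1"
  shows "qmul (slice_embed v z) (slice_embed v w) = slice_embed v (z * w)"
proof -
  obtain p q r where v: "v = (p, q, r)" by (cases v)
  have "p\<^sup>2 + (q\<^sup>2 + r\<^sup>2) = 1" using assms by (simp add: v norm_Pair)
  then have "Im z * Im w = Im z * Im w * (p\<^sup>2 + (q\<^sup>2 + r\<^sup>2))" by simp
  then show ?thesis
    by (simp add: slice_embed_def qmul_def v algebra_simps power2_eq_square)
qed

text \<open>Moves evaluation into a commutative field, where a product of polynomials evaluates to
  the product of the values.\<close>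

lemma norm_qpoly: "norm (qpoly P x) = cmod (poly (map_poly of_real P) (slice x))"
proof -
  obtain v where v: "norm v = 1" "x = slice_embed v (slice x)" by (rule slice_embed_slice)
  have "qpow (slice_embed v z) k = slice_embed v (z ^ k)" for z k
    using slice_embed_of_real[of v 1]
    by (induction k) (simp_all add: qmul_slice_embed[OF v(1)] qone_def qof_real_def)
  then have "qpoly P (slice_embed v z) = slice_embed v (poly (map_poly of_real P) z)" for z
    by (simp add: qpoly_def poly_altdef degree_map_poly coeff_map_poly
        slice_embed_sum slice_embed_of_real_mult)
  then show ?thesis
    using v norm_slice_embed[OF v(1)] by metis
qed

lemma norm_diff_qof_real: "norm (x - qof_real r) = cmod (slice x - of_real r)"
proof -
  obtain v where v: "norm v = 1" "x = slice_embed v (slice x)" by (rule slice_embed_slice)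
  then have "x - qof_real r = slice_embed v (slice x - of_real r)"
    by (simp add: slice_embed_diff slice_embed_of_real)
  then show ?thesis by (simp add: norm_slice_embed v(1))
qed

lemma norm_quadratic:
  "norm (qmul x x - (2 * Re a) *\<^sub>R x + qof_real ((cmod a)\<^sup>2))
     = cmod (slice x - a) * cmod (slice x - cnj a)"
proof -
  obtain v where v: "norm v = 1" "x = slice_embed v (slice x)" by (rule slice_embed_slice)
  define z where "z = slice x"
  have "qmul x x - (2 * Re a) *\<^sub>R x + qof_real ((cmod a)\<^sup>2)
      = slice_embed v (z * z - of_real (2 * Re a) * z + of_real ((cmod a)\<^sup>2))"
    unfolding slice_embed_add slice_embed_diff slice_embed_of_real_mult slice_embed_of_real
    using v by (simp add: z_def flip: qmul_slice_embed)
  also have "z * z - of_real (2 * Re a) * z + of_real ((cmod a)\<^sup>2) = (z - a) * (z - cnj a)"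
    unfolding complex_norm_square complex_add_cnj[symmetric] by (simp add: algebra_simps)
  finally show ?thesis
    by (simp add: norm_slice_embed[OF v(1)] norm_mult z_def)
qed

section \<open>Mahler measures of linear and quadratic factors and of their products\<close>

lemma has_bochner_integral_ln_norm_quadratic:
  "has_bochner_integral sphere3
     (\<lambda>x. ln (norm (qmul x x - (2 * Re a) *\<^sub>R x + qof_real ((cmod a)\<^sup>2))))
     (if cmod a \<le> 1 then Re (a\<^sup>2) / 2 else 2 * ln (cmod a) + Re (a\<^sup>2) / (2 * cmod a ^ 4))"
proof -
  have "AE x in sphere3. ln_conj_dist a x = ln (cmod (slice x - a) * cmod (slice x - cnj a))"
    using AE_slice_neq[of a]
    by eventually_elim (simp add: ln_conj_dist_def ln_mult)
  then show ?thesis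
    unfolding norm_quadratic
    by (intro has_bochner_integral_cong_AE[THEN iffD1, OF _ _ _ has_bochner_integral_ln_conj_dist]) auto
qed

text \<open>For real \<open>r\<close> the two conjugate logarithms coincide, so every value is half
  of the one for a conjugate pair.\<close>

lemma has_bochner_integral_ln_norm_diff:
  "has_bochner_integral sphere3 (\<lambda>x. ln (norm (x - qof_real r)))
     (if \<bar>r\<bar> \<le> 1 then r\<^sup>2 / 4 else ln \<bar>r\<bar> + 1 / (4 * r\<^sup>2))"
proof -
  have eq: "(\<lambda>x. ln (norm (x - qof_real r))) = (\<lambda>x. (1 / 2) * ln_conj_dist (of_real r) x)"
    by (simp add: norm_diff_qof_real ln_conj_dist_def)
  have "r\<^sup>2 / \<bar>r\<bar> ^ 4 = 1 / r\<^sup>2" if "r \<noteq> 0"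
    using that by (simp add: power4_eq_xxxx power2_eq_square)
  then have val: "(if \<bar>r\<bar> \<le> 1 then r\<^sup>2 / 4 else ln \<bar>r\<bar> + 1 / (4 * r\<^sup>2))
      = 1 / 2 * (if cmod (of_real r) \<le> 1 then Re ((of_real r)\<^sup>2) / 2
        else 2 * ln (cmod (of_real r)) + Re ((of_real r)\<^sup>2) / (2 * cmod (of_real r) ^ 4))"
    by (cases "r = 0") (auto simp: field_simps simp flip: of_real_power)
  show ?thesis unfolding eq val
    by (intro has_bochner_integral_mult_right has_bochner_integral_ln_conj_dist)
qed

text \<open>An orthogonal map of R^4 taking |a| on the real axis to \<open>a\<close> preserves both
  the measure and distances.\<close>

lemma mH_diff_qof_real_norm: "mH (\<lambda>x. x - a) = mH (\<lambda>x. x - qof_real (norm a))"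
proof -
  obtain f where f: "orthogonal_transformation f" "f (qof_real (norm a)) = a"
    using orthogonal_transformation_exists_norm[of "qof_real (norm a)" a]
    by (auto simp: qof_real_def norm_Pair)
  have [measurable]: "f \<in> borel_measurable borel"
    using f(1) by (rule borel_measurable_orthogonal_transformation)
  have "mH (\<lambda>x. x - a) = (\<integral>x. ln (norm (x - a)) \<partial>distr sphere3 borel f)"
    by (simp add: mH_def sphere3_distr_orthogonal_transformation[OF f(1)])
  also have "\<dots> = (\<integral>x. ln (norm (f x - f (qof_real (norm a)))) \<partial>sphere3)"
    by (subst integral_distr) (simp_all add: f(2))
  also have "\<dots> = mH (\<lambda>x. x - qof_real (norm a))"
    using orthogonal_transformation_linear[OF f(1)] orthogonal_transformation_norm[OF f(1)]
    by (simp add: mH_def flip: linear_diff)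
  finally show ?thesis .
qed

text \<open>The quadratic depends only on the real part and norm of \<alpha>, which
  \<open>slice \<alpha>\<close> shares; \<phi> is the argument of that complex number, so its square
  has real part \<open>(norm \<alpha>)^2 * cos (2 * \<phi>)\<close>.\<close>

lemma mH_quadratic:
  fixes \<alpha> :: quat
  assumes "\<alpha> \<noteq> 0"
  defines "\<phi> \<equiv> arccos (qre \<alpha> / norm \<alpha>)"
  shows "mH (\<lambda>x. qmul x x - (2 * qre \<alpha>) *\<^sub>R x + qof_real ((norm \<alpha>)\<^sup>2)) =
    (if norm \<alpha> \<le> 1 then (norm \<alpha>)\<^sup>2 / 2 * cos (2 * \<phi>)
     else cos (2 * \<phi>) / (2 * (norm \<alpha>)\<^sup>2) + 2 * ln (norm \<alpha>))"
proof -
  define r where "r = norm \<alpha>"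
  have r: "r > 0" using assms(1) by (simp add: r_def)
  have Re_le: "\<bar>qre \<alpha>\<bar> \<le> r"
    using norm_fst_le[of "fst \<alpha>" "snd \<alpha>"] by (simp add: qre_def r_def)
  then have "cos \<phi> = qre \<alpha> / r"
    using r unfolding \<phi>_def r_def by (intro cos_arccos) (auto simp: field_simps abs_le_iff r_def)
  then have cos2: "cos (2 * \<phi>) = (2 * (qre \<alpha>)\<^sup>2 - r\<^sup>2) / r\<^sup>2"
    using r unfolding cos_double_cos by (simp add: power_divide diff_divide_distrib)
  have "r\<^sup>2 = (Re (slice \<alpha>))\<^sup>2 + (Im (slice \<alpha>))\<^sup>2"
    by (simp only: r_def cmod_power2[symmetric] cmod_slice)
  then have "Re ((slice \<alpha>)\<^sup>2) = 2 * (qre \<alpha>)\<^sup>2 - r\<^sup>2"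
    by (simp add: slice_def qre_def power2_eq_square)
  also have "\<dots> = r\<^sup>2 * cos (2 * \<phi>)" using r by (simp add: cos2)
  finally have sq: "Re ((slice \<alpha>)\<^sup>2) = r\<^sup>2 * cos (2 * \<phi>)" .
  have "qre \<alpha> = Re (slice \<alpha>)" by (simp add: qre_def slice_def)
  then show ?thesis
    using has_bochner_integral_ln_norm_quadratic[of "slice \<alpha>"] r
    unfolding mH_def sq cmod_slice r_def[symmetric]
    by (auto simp: has_bochner_integral_iff power4_eq_xxxx power2_eq_square)
qed

lemma map_poly_of_real_mult:
  "map_poly of_real (p * q) = (map_poly of_real p * map_poly of_real q :: complex poly)"
  by (rule poly_eqI) (simp add: coeff_map_poly coeff_mult)

lemma map_poly_of_real_power:
  "map_poly of_real (p ^ n) = (map_poly of_real p ^ n :: complex poly)"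
  by (induction n) (simp_all add: map_poly_of_real_mult)

lemma map_poly_of_real_prod:
  "map_poly of_real (\<Prod>i\<in>I. p i) = (\<Prod>i\<in>I. map_poly of_real (p i) :: complex poly)"
  by (induction I rule: infinite_finite_induct) (simp_all add: map_poly_of_real_mult)

text \<open>The logarithm of the product splits wherever no factor vanishes, hence almost
  everywhere; integrability of each factor's logarithm then lets the integral be distributed over
  the sum.\<close>

lemma mH_qpoly_factored:
  fixes a :: "nat \<Rightarrow> real" and b :: "nat \<Rightarrow> complex"
  assumes "c \<noteq> 0"
    and P: "P = smult c ((\<Prod>h<H. [:- a h, 1:] ^ n h) *
              (\<Prod>l<L. [:cmod (b l) ^ 2, - 2 * Re (b l), 1:] ^ m l))"
  shows "mH (qpoly P) = ln \<bar>c\<bar>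
    + (\<Sum>h<H. real (n h) * mH (\<lambda>x. x - qof_real (a h)))
    + (\<Sum>l<L. real (m l) * mH (\<lambda>x. qmul x x - (2 * Re (b l)) *\<^sub>R x + qof_real (cmod (b l) ^ 2)))"
proof -
  define A where "A h x = ln (norm (x - qof_real (a h)))" for h x
  define B where "B l x = ln (norm (qmul x x - (2 * Re (b l)) *\<^sub>R x + qof_real (cmod (b l) ^ 2)))" for l x
  have A: "integrable sphere3 (A h)" for h
    unfolding A_def[abs_def] using has_bochner_integral_ln_norm_diff by (auto simp: has_bochner_integral_iff)
  have B: "integrable sphere3 (B l)" for l
    unfolding B_def[abs_def] using has_bochner_integral_ln_norm_quadratic by (auto simp: has_bochner_integral_iff)
  have lin: "cmod (poly (map_poly of_real [:- a h, 1:]) (slice x)) = norm (x - qof_real (a h))" for h x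
    by (simp add: norm_diff_qof_real map_poly_pCons)
  have quad: "cmod (poly (map_poly of_real [:cmod (b l) ^ 2, - 2 * Re (b l), 1:]) (slice x))
      = norm (qmul x x - (2 * Re (b l)) *\<^sub>R x + qof_real (cmod (b l) ^ 2))" for l x
  proof -
    define z where "z = slice x"
    have "poly (map_poly of_real [:cmod (b l) ^ 2, - 2 * Re (b l), 1:]) z
        = z * z - of_real (2 * Re (b l)) * z + of_real ((cmod (b l))\<^sup>2)"
      by (simp add: map_poly_pCons algebra_simps)
    also have "\<dots> = (z - b l) * (z - cnj (b l))"
      unfolding complex_norm_square complex_add_cnj[symmetric] by (simp add: algebra_simps)
    finally show ?thesis by (simp add: norm_quadratic norm_mult z_def)
  qed
  \<comment> \<open>Quantifying over all indices instead of those below \<open>H\<close> and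
    \<open>L\<close> is harmless, since countably many null sets are removed.\<close>
  have "AE x in sphere3. (\<forall>h. slice x \<noteq> of_real (a h)) \<and> (\<forall>l. slice x \<noteq> b l \<and> slice x \<noteq> cnj (b l))"
    using AE_slice_neq by (auto simp: AE_all_countable AE_conj_iff elim!: eventually_mono)
  then have "AE x in sphere3. ln (norm (qpoly P x))
      = ln \<bar>c\<bar> + (\<Sum>h<H. real (n h) * A h x) + (\<Sum>l<L. real (m l) * B l x)"
  proof eventually_elim
    fix x assume x: "(\<forall>h. slice x \<noteq> of_real (a h)) \<and> (\<forall>l. slice x \<noteq> b l \<and> slice x \<noteq> cnj (b l))"
    have A0: "norm (x - qof_real (a h)) \<noteq> 0" for h
      using x unfolding norm_diff_qof_real by simp
    have B0: "norm (qmul x x - (2 * Re (b l)) *\<^sub>R x + qof_real (cmod (b l) ^ 2)) \<noteq> 0" for l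
      using x unfolding norm_quadratic by simp
    have "norm (qpoly P x) = \<bar>c\<bar> * ((\<Prod>h<H. norm (x - qof_real (a h)) ^ n h) *
        (\<Prod>l<L. norm (qmul x x - (2 * Re (b l)) *\<^sub>R x + qof_real (cmod (b l) ^ 2)) ^ m l))"
      unfolding norm_qpoly P
      by (simp only: map_poly_smult of_real_0 of_real_mult poly_smult norm_mult norm_of_real
          map_poly_of_real_mult map_poly_of_real_prod map_poly_of_real_power poly_mult poly_prod
          poly_power norm_power prod_norm[symmetric] lin quad)
    then show "ln (norm (qpoly P x))
        = ln \<bar>c\<bar> + (\<Sum>h<H. real (n h) * A h x) + (\<Sum>l<L. real (m l) * B l x)"
      using \<open>c \<noteq> 0\<close> A0 B0 by (simp add: ln_mult ln_prod ln_realpow A_def B_def)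
  qed
  moreover have [measurable]: "poly p \<in> borel_measurable borel" for p :: "complex poly"
    by (intro borel_measurable_continuous_onI continuous_intros)
  ultimately have "mH (qpoly P) = (\<integral>x. ln \<bar>c\<bar> + (\<Sum>h<H. real (n h) * A h x) + (\<Sum>l<L. real (m l) * B l x) \<partial>sphere3)"
    unfolding mH_def
    by (intro integral_cong_AE) (auto simp: norm_qpoly[abs_def] A_def B_def norm_diff_qof_real norm_quadratic)
  also have "\<dots> = ln \<bar>c\<bar> + (\<Sum>h<H. real (n h) * integral\<^sup>L sphere3 (A h))
      + (\<Sum>l<L. real (m l) * integral\<^sup>L sphere3 (B l))"
    using A B by simp
  finally show ?thesis by (simp add: mH_def A_def[abs_def] B_def[abs_def])
qed

theorem theorem1p1:
  shows "(\<forall>\<alpha>::quat. mH (\<lambda>x. x - \<alpha>) =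
            (if norm \<alpha> \<le> 1 then norm \<alpha> ^ 2 / 4
             else 1 / (4 * norm \<alpha> ^ 2) + ln (norm \<alpha>)))
       \<and> (\<forall>\<alpha>::quat. \<alpha> \<noteq> 0 \<longrightarrow>
            (let \<phi> = arccos (qre \<alpha> / norm \<alpha>) in
             mH (\<lambda>x. qmul x x - (2 * qre \<alpha>) *\<^sub>R x + qof_real (norm \<alpha> ^ 2)) =
             (if norm \<alpha> \<le> 1 then norm \<alpha> ^ 2 / 2 * cos (2 * \<phi>)
              else cos (2 * \<phi>) / (2 * norm \<alpha> ^ 2) + 2 * ln (norm \<alpha>))))
       \<and> (\<forall>(P::real poly) (c::real) (H::nat) (a::nat \<Rightarrow> real) (n::nat \<Rightarrow> nat)
             (L::nat) (b::nat \<Rightarrow> complex) (m::nat \<Rightarrow> nat).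
            P \<noteq> 0 \<longrightarrow> c \<noteq> 0 \<longrightarrow> (\<forall>l<L. Im (b l) \<noteq> 0) \<longrightarrow>
            P = smult c ((\<Prod>h<H. [:- a h, 1:] ^ n h) *
                         (\<Prod>l<L. [:cmod (b l) ^ 2, - 2 * Re (b l), 1:] ^ m l)) \<longrightarrow>
            mH (qpoly P) =
              ln \<bar>c\<bar>
              + (\<Sum>h<H. real (n h) * mH (\<lambda>x. x - qof_real (a h)))
              + (\<Sum>l<L. real (m l) *
                   mH (\<lambda>x. qmul x x - (2 * Re (b l)) *\<^sub>R x + qof_real (cmod (b l) ^ 2))))"
proof (intro conjI allI impI)
  fix \<alpha> :: quat
  show "mH (\<lambda>x. x - \<alpha>) = (if norm \<alpha> \<le> 1 then norm \<alpha> ^ 2 / 4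
      else 1 / (4 * norm \<alpha> ^ 2) + ln (norm \<alpha>))"
    using has_bochner_integral_ln_norm_diff[of "norm \<alpha>"]
    unfolding mH_diff_qof_real_norm[of \<alpha>] by (simp add: mH_def has_bochner_integral_iff)
qed (simp_all only: Let_def mH_quadratic mH_qpoly_factored not_False_eq_True)

end
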